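(* Let $\mathbb{G}$ be a stratified group with $N$ the dimension of its first stratum, let $n\ge 2$, and let $\Omega\subset\mathbb{G}^n$ be an open set. Let $$\rho^2:=\sum_{1\le i<j\le n}|(x_ix_j^{-1})'|^2=\sum_{1\le i<j\le n}|x'_i-x'_j|^2,$$ with $x'_i\ne x'_j$ for $i\neq j$ (for $x=(x_1,\ldots,x_n)\in\Omega$). Then $$\int_\Omega|\nabla_{\mathbb{G}^n}u|^2\,dx=n\left(\frac{n-1}{2}N-1\right)^2\int_\Omega\frac{|u|^2}{\rho^2}\,dx+\int_\Omega\left|\nabla_{\mathbb{G}^n}\left(\rho^{-2\alpha}u\right)\right|^2\rho^{4\alpha}\,dx$$ for all $u\in C_0^\infty(\Omega)$, with $\alpha=\frac{2-(n-1)N}{4}$.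
   Context: A stratified group (homogeneous Carnot group) $\mathbb{G}=(\mathbb{R}^d,\circ,\delta_\lambda)$ of step $r$ is a Lie group structure on $\mathbb{R}^d$, with points written $y=(y',y^{(2)},\ldots,y^{(r)})$, $y'=(y'_1,\ldots,y'_N)\in\mathbb{R}^N$ (the first stratum coordinates), $y^{(l)}\in\mathbb{R}^{N_l}$, such that the dilations $\delta_\lambda(y)=(\lambda y',\lambda^2y^{(2)},\ldots,\lambda^ry^{(r)})$, $\lambda>0$, are group automorphisms, and such that the left-invariant vector fields $X_1,\ldots,X_N$ with $X_k(0)=\partial/\partial y'_k|_0$ (the Jacobian generators of the first stratum) generate, together with their iterated commutators, the whole Lie algebra. Explicitly, $X_k=\frac{\partial}{\partial y'_k}+\sum_{l=2}^{r}\sum_{m=1}^{N_l}a^{(l)}_{k,m}(y',\ldots,y^{(l-1)})\frac{\partial}{\partial y^{(l)}_m}$. $\mathbb{G}^n=\mathbb{G}\times\cdots\times\mathbb{G}$ ($n$ factors) with points $x=(x_1,\ldots,x_n)$, $x_i\in\mathbb{G}$ (the $i$-th particle), and $x'_i=(x'_{i1},\ldots,x'_{iN})$ the first stratum coordinates of $x_i$; one has $(x_ix_j^{-1})'=x'_i-x'_j$, and $|\cdot|$ is the Euclidean norm. $X_{ik}$ denotes the vector field $X_k$ acting in the variable $x_i$, $\nabla_{\mathbb{G}_i}=(X_{i1},\ldots,X_{iN})$, and $\nabla_{\mathbb{G}^n}=(\nabla_{\mathbb{G}_1},\ldots,\nabla_{\mathbb{G}_n})$. $dx$ is Lebesgue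 measure (Haar measure) on $\mathbb{G}^n$. *)

theory Defs
  imports "HOL-Analysis.Analysis" "HOL-Algebra.Group"
begin

text \<open>\<open>times_differentiable_on\<close> is meant for open sets only, since it uses the
  two-sided \<open>frechet_derivative\<close>.\<close>

primrec times_differentiable_on ::
  "nat \<Rightarrow> 'a::euclidean_space set \<Rightarrow> ('a \<Rightarrow> 'b::real_normed_vector) \<Rightarrow> bool" where
  "times_differentiable_on 0 S f \<longleftrightarrow> continuous_on S f"
| "times_differentiable_on (Suc m) S f \<longleftrightarrow>
     (\<forall>x\<in>S. f differentiable (at x)) \<and>
     (\<forall>v. times_differentiable_on m S (\<lambda>x. frechet_derivative f (at x) v))"

definition smooth_on :: "'a::euclidean_space set \<Rightarrow> ('a \<Rightarrow> 'b::real_normed_vector) \<Rightarrow> bool" where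
  "smooth_on S f \<longleftrightarrow> (\<forall>m. times_differentiable_on m S f)"

text \<open>The space \<open>C\<^sub>0\<^sup>\<infinity>(\<Omega>)\<close>; its elements are extended by zero outside \<open>\<Omega>\<close>.\<close>

definition test_functions :: "'a::euclidean_space set \<Rightarrow> ('a \<Rightarrow> complex) set" where
  "test_functions \<Omega> =
     {u. smooth_on \<Omega> u \<and> compact (closure {x. u x \<noteq> 0}) \<and> closure {x. u x \<noteq> 0} \<subseteq> \<Omega>}"

definition vf_apply ::
  "('a::euclidean_space \<Rightarrow> 'a) \<Rightarrow> ('a \<Rightarrow> 'b::real_normed_vector) \<Rightarrow> 'a \<Rightarrow> 'b" where
  "vf_apply V f y = frechet_derivative f (at y) (V y)"

text \<open>The commutator \<open>VW - WV\<close> of first-order operators, written as a vector field.\<close>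

definition lie_bracket ::
  "('a::euclidean_space \<Rightarrow> 'a) \<Rightarrow> ('a \<Rightarrow> 'a) \<Rightarrow> 'a \<Rightarrow> 'a" where
  "lie_bracket V W y = vf_apply V W y - vf_apply W V y"

inductive_set lie_generated ::
  "('a::euclidean_space \<Rightarrow> 'a) set \<Rightarrow> ('a \<Rightarrow> 'a) set" for S where
  generator: "V \<in> S \<Longrightarrow> V \<in> lie_generated S"
| zero: "(\<lambda>y. 0) \<in> lie_generated S"
| add: "V \<in> lie_generated S \<Longrightarrow> W \<in> lie_generated S \<Longrightarrow> (\<lambda>y. V y + W y) \<in> lie_generated S"
| scale: "V \<in> lie_generated S \<Longrightarrow> (\<lambda>y. c *\<^sub>R V y) \<in> lie_generated S"
| bracket: "V \<in> lie_generated S \<Longrightarrow> W \<in> lie_generated S \<Longrightarrow> lie_bracket V W \<in> lie_generated S"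

definition left_invariant_fields ::
  "'a::euclidean_space monoid \<Rightarrow> ('a \<Rightarrow> 'a) set" where
  "left_invariant_fields G =
     {V. smooth_on UNIV V \<and>
         (\<forall>x y. V (x \<otimes>\<^bsub>G\<^esub> y) = frechet_derivative (\<lambda>z. x \<otimes>\<^bsub>G\<^esub> z) (at y) (V y))}"

text \<open>The left-invariant vector field which equals \<open>\<partial>/\<partial>y\<^sub>k\<close> at the origin, i.e. the
  \<open>k\<close>-th column of the Jacobian matrix at \<open>0\<close> of the left translation by \<open>y\<close>.\<close>

definition jacobian_generator :: "(real^'d) monoid \<Rightarrow> 'd \<Rightarrow> real^'d \<Rightarrow> real^'d" where
  "jacobian_generator G k y = frechet_derivative (\<lambda>z. y \<otimes>\<^bsub>G\<^esub> z) (at 0) (axis k 1)"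

text \<open>The splitting \<open>y = (y', y\<^sup>(\<^sup>2\<^sup>), \<dots>, y\<^sup>(\<^sup>r\<^sup>))\<close> of the coordinates is encoded by
  \<open>wt\<close>: the coordinate \<open>y $ k\<close> belongs to the stratum number \<open>wt k\<close>. In
  particular \<open>y'\<close> consists of the coordinates of weight \<open>1\<close>.\<close>

definition dilation :: "('d \<Rightarrow> nat) \<Rightarrow> real \<Rightarrow> real^'d \<Rightarrow> real^'d" where
  "dilation wt c y = (\<chi> k. c ^ wt k * y $ k)"

locale stratified_group = group G
  for G :: "(real^'d) monoid" (structure)
    and wt :: "'d \<Rightarrow> nat"
    and r :: nat +
  assumes carrier_UNIV: "carrier G = UNIV"
    and smooth_mult: "smooth_on UNIV (\<lambda>(x, y). x \<otimes> y)"
    and smooth_inv: "smooth_on UNIV (\<lambda>x. inv x)"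
    and strata: "range wt = {1..r}"
    and dilation_automorphism: "0 < c \<Longrightarrow> dilation wt c \<in> iso G G"
    and first_stratum_generates:
      "lie_generated {jacobian_generator G k | k. wt k = 1} = left_invariant_fields G"

text \<open>The vector \<open>y'\<close>, regarded as an element of \<open>\<real>\<^sup>d\<close> by padding with zeros, so that
  \<open>norm (first_stratum wt y)\<close> is its Euclidean norm.\<close>

definition first_stratum :: "('d \<Rightarrow> nat) \<Rightarrow> real^'d \<Rightarrow> real^'d" where
  "first_stratum wt y = (\<chi> k. if wt k = 1 then y $ k else 0)"

text \<open>A point of \<open>\<real>^'d^'n\<close> is a configuration \<open>x = (x\<^sub>1, \<dots>, x\<^sub>n)\<close> of \<open>n = CARD('n)\<close>
  particles \<open>x $ i\<close> in the group.\<close>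

definition rho :: "(real^'d) monoid \<Rightarrow> ('d \<Rightarrow> nat) \<Rightarrow> real^'d^('n::{finite,linorder}) \<Rightarrow> real" where
  "rho G wt x =
     sqrt (\<Sum>(i, j) \<in> {(i, j). i < j}. (norm (first_stratum wt (x $ i \<otimes>\<^bsub>G\<^esub> inv\<^bsub>G\<^esub> (x $ j))))\<^sup>2)"

text \<open>\<open>X\<^sub>i\<^sub>k u\<close>: the field \<open>X\<^sub>k\<close> acting in the variable \<open>x\<^sub>i\<close>, the other variables being frozen.\<close>

definition particle_field ::
  "(real^'d) monoid \<Rightarrow> 'n \<Rightarrow> 'd \<Rightarrow> (real^'d^'n \<Rightarrow> complex) \<Rightarrow> real^'d^'n \<Rightarrow> complex" where
  "particle_field G i k u x =
     vf_apply (jacobian_generator G k) (\<lambda>y. u (\<chi> j. if j = i then y else x $ j)) (x $ i)"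

text \<open>The gradient \<open>(X\<^sub>i\<^sub>k u)\<close> with \<open>k\<close> ranging over the first stratum; the components for all other
  \<open>k\<close> are zero, so they do not contribute to the norm.\<close>

definition horizontal_gradient ::
  "(real^'d) monoid \<Rightarrow> ('d \<Rightarrow> nat) \<Rightarrow> (real^'d^'n \<Rightarrow> complex) \<Rightarrow> real^'d^'n \<Rightarrow> complex^'d^'n" where
  "horizontal_gradient G wt u x = (\<chi> i k. if wt k = 1 then particle_field G i k u x else 0)"

end

theory Submission
  imports Defs
begin

text \<open>Write \<open>R = \<rho>\<^sup>2\<close> and \<open>v = R\<^sup>-\<^sup>\<alpha> u\<close>. The identity is the ground state substitution \<open>u = R\<^sup>\<alpha> v\<close>
  followed by one integration by parts.

  Two facts about the group enter, both from the dilations. The smooth function \<open>(xy)\<^sub>k\<close> is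
  homogeneous of degree \<open>1\<close> for a first stratum coordinate \<open>k\<close>, so it equals its own linearisation at
  the identity, and that only sees first stratum coordinates; hence \<open>(xy)' = x' + y'\<close>
  (\<open>first_stratum_mult\<close>). This turns \<open>R\<close> into a quadratic form in the coordinates \<open>x\<^sub>i\<^sub>k\<close> of the first
  stratum, on which \<open>X\<^sub>i\<^sub>k\<close> acts as \<open>\<partial>/\<partial>x\<^sub>i\<^sub>k\<close>. Moreover the \<open>l\<close>-th coefficient of \<open>X\<^sub>k\<close>
  does not vary along the \<open>l\<close>-th coordinate (\<open>jacobian_generator_coefficient\<close>), so \<open>X\<^sub>i\<^sub>k\<close> is divergence
  free and \<open>\<integral> X\<^sub>i\<^sub>k g = 0\<close> for every continuously differentiable \<open>g\<close> with compact support
  (\<open>integral_divergence_free_field_eq_zero\<close>).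

  Let \<open>T\<^sub>i\<^sub>k = n x\<^sub>i\<^sub>k - \<Sum>\<^sub>j x\<^sub>j\<^sub>k\<close>. Then \<open>X\<^sub>i\<^sub>k R = 2 T\<^sub>i\<^sub>k\<close>, \<open>X\<^sub>i\<^sub>k T\<^sub>i\<^sub>k = n - 1\<close> and
  \<open>\<Sum> T\<^sub>i\<^sub>k\<^sup>2 = n R\<close>. The product rule gives \<open>R\<^sup>\<alpha> X\<^sub>i\<^sub>k v = X\<^sub>i\<^sub>k u - (2 \<alpha> T\<^sub>i\<^sub>k / R) u\<close>. Expanding the
  square and writing the cross term as \<open>2 \<alpha> (X\<^sub>i\<^sub>k \<bar>u\<bar>\<^sup>2) T\<^sub>i\<^sub>k / R\<close> leads to the pointwise identity
  \<open>hardy_expansion\<close>: apart from the two gradient terms it consists of the total derivative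
  \<open>X\<^sub>i\<^sub>k (2 \<alpha> \<bar>u\<bar>\<^sup>2 T\<^sub>i\<^sub>k / R)\<close>, whose integral vanishes, and a multiple of \<open>\<bar>u\<bar>\<^sup>2\<close>. Summed over \<open>i\<close> and \<open>k\<close>,
  the multiple is \<open>n (4 \<alpha> - 4 \<alpha>\<^sup>2 - 2 \<alpha> (n - 1) N) / R\<close>, and \<open>(n - 1) N = 2 - 4 \<alpha>\<close> makes this
  \<open>4 n \<alpha>\<^sup>2 / R\<close>, which is the constant of the theorem.

  All integrands are continuous on \<open>\<Omega>\<close> and vanish off the support of \<open>u\<close>, so they are integrable; the
  singularities of \<open>1/R\<close> stay away because \<open>R > 0\<close> on \<open>\<Omega>\<close>.\<close>

section \<open>Integration by parts\<close>

lemma has_derivative_directional: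
  assumes "(h has_derivative h') (at x)"
  shows "((\<lambda>t. h (x + t *\<^sub>R b)) has_vector_derivative h' b) (at 0)"
proof -
  have "((\<lambda>t. x + t *\<^sub>R b) has_derivative (\<lambda>t. t *\<^sub>R b)) (at 0)"
    by (auto intro!: derivative_eq_intros)
  then have "((\<lambda>t. h (x + t *\<^sub>R b)) has_derivative (\<lambda>t. h' (t *\<^sub>R b))) (at 0)"
    by (rule has_derivative_compose) (use assms in simp)
  moreover have "h' (t *\<^sub>R b) = t *\<^sub>R h' b" for t
    using assms by (simp add: has_derivative_linear linear_cmul)
  ultimately show ?thesis by (simp add: has_vector_derivative_def)
qed

lemma has_derivative_zero_outside_support:
  fixes g :: "'a::real_normed_vector \<Rightarrow> 'b::real_normed_vector"
  assumes "closed K" "x \<notin> K" "\<And>y. y \<notin> K \<Longrightarrow> g y = 0"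
  shows "(g has_derivative (\<lambda>b. 0)) (at x)"
  by (rule has_derivative_transform_within_open[of "\<lambda>x. 0" _ _ _ "- K"]) (use assms in auto)

lemma integrable_continuous_zero_outside_compact:
  fixes f :: "'a::euclidean_space \<Rightarrow> 'b::euclidean_space"
  assumes "compact K" "continuous_on K f" "\<And>x. x \<notin> K \<Longrightarrow> f x = 0"
  shows "integrable lborel f"
proof -
  have "(\<lambda>x. indicator K x *\<^sub>R f x) = f"
    using assms(3) by (auto simp: indicator_def)
  then show ?thesis using borel_integrable_compact[OF assms(1,2)] by simp
qed

text \<open>Every difference quotient of \<open>h\<close> in the direction \<open>b\<close> has integral \<open>0\<close>, because Lebesgue measure is
  translation invariant. The quotients are bounded by \<open>sup \<bar>\<partial>\<^sub>b h\<bar>\<close> (mean value theorem) and live in a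
  fixed ball, so dominated convergence passes this on to the derivative.\<close>

lemma integral_directional_derivative_eq_zero:
  fixes h :: "'a::euclidean_space \<Rightarrow> real"
  assumes deriv: "\<And>x. (h has_derivative h' x) (at x)"
    and cont: "continuous_on UNIV (\<lambda>x. h' x b)"
    and K: "compact K" "\<And>x. x \<notin> K \<Longrightarrow> h x = 0"
  shows "(\<integral>x. h' x b \<partial>lborel) = 0"
proof -
  have h'0: "h' x b = 0" if "x \<notin> K" for x
    using has_derivative_unique[OF deriv has_derivative_zero_outside_support[OF compact_imp_closed[OF K(1)] that K(2)]]
    by simp
  have conth: "continuous_on UNIV h"
    by (intro has_derivative_continuous_on) (use deriv has_derivative_at_withinI in blast)
  have inth: "integrable lborel h"
    using conth K integrable_continuous_zero_outside_compact continuous_on_subset by blast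
  obtain M where M: "\<And>x. \<bar>h' x b\<bar> \<le> M" "0 \<le> M"
  proof -
    have "bounded ((\<lambda>x. h' x b) ` K)"
      using K(1) cont by (meson compact_continuous_image compact_imp_bounded continuous_on_subset subset_UNIV)
    then obtain M where "M > 0" "\<forall>y\<in>(\<lambda>x. h' x b) ` K. norm y \<le> M" by (auto simp: bounded_pos)
    then show ?thesis using h'0 by (intro that[of M]) (force, simp)
  qed
  obtain r where r: "\<And>x. x \<in> K \<Longrightarrow> norm x \<le> r" "r > 0"
    using compact_imp_bounded[OF K(1)] by (auto simp: bounded_pos)
  define c where "c m = 1 / real (Suc m)" for m
  have c: "0 < c m" "c m \<le> 1" for m by (auto simp: c_def)
  have c0: "c \<longlonglongrightarrow> 0" unfolding c_def by (rule LIMSEQ_Suc[OF lim_1_over_n])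
  define q where "q m x = (h (x + c m *\<^sub>R b) - h x) / c m" for m x
  have shift: "integrable lborel (\<lambda>x. h (x + c m *\<^sub>R b))"
      "(\<integral>x. h (x + c m *\<^sub>R b) \<partial>lborel) = (\<integral>x. h x \<partial>lborel)" for m
  proof -
    have *: "distr lborel borel (\<lambda>x. x + c m *\<^sub>R b) = lborel"
      using lborel_distr_plus[of "c m *\<^sub>R b"] by (simp add: add.commute[of _ "c m *\<^sub>R b"])
    have "integrable (distr lborel borel (\<lambda>x. x + c m *\<^sub>R b)) h"
      using inth by (simp only: *)
    then show "integrable lborel (\<lambda>x. h (x + c m *\<^sub>R b))"
      by (subst (asm) integrable_distr_eq) (use inth in auto)
    show "(\<integral>x. h (x + c m *\<^sub>R b) \<partial>lborel) = (\<integral>x. h x \<partial>lborel)"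
      by (subst (2) *[symmetric], subst integral_distr) (use inth in auto)
  qed
  have q0: "(\<integral>x. q m x \<partial>lborel) = 0" for m
    using shift[of m] inth by (simp add: q_def)
  have "(\<lambda>m. \<integral>x. q m x \<partial>lborel) \<longlonglongrightarrow> (\<integral>x. h' x b \<partial>lborel)"
  proof (rule integral_dominated_convergence[where w = "\<lambda>x. indicator (cball 0 (r + norm b)) x *\<^sub>R M"])
    \<comment> \<open>The increments are at most \<open>b\<close> in length, so the translates of \<open>K\<close> stay in this ball.\<close>
    show "integrable lborel (\<lambda>x::'a. indicator (cball 0 (r + norm b)) x *\<^sub>R M)"
      by (intro borel_integrable_compact) auto
    show "(\<lambda>x. h' x b) \<in> borel_measurable lborel"
      using cont by (simp add: borel_measurable_continuous_onI)
    show "q m \<in> borel_measurable lborel" for m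
      using shift[of m] inth unfolding q_def by measurable
    show "AE x in lborel. (\<lambda>m. q m x) \<longlonglongrightarrow> h' x b"
    proof (rule AE_I2)
      fix x
      have "((\<lambda>t. h (x + t *\<^sub>R b)) has_real_derivative h' x b) (at 0)"
        using has_derivative_directional[OF deriv]
        by (simp add: has_real_derivative_iff_has_vector_derivative)
      then have "((\<lambda>t. (h (x + t *\<^sub>R b) - h x) / t) \<longlongrightarrow> h' x b) (at 0)"
        by (simp add: has_field_derivative_def DERIV_def flip: has_field_derivative_def)
      moreover have "filterlim c (at 0) sequentially"
        using c0 c(1) by (auto simp: filterlim_at less_imp_neq[symmetric])
      ultimately show "(\<lambda>m. q m x) \<longlonglongrightarrow> h' x b"
        unfolding q_def by (rule filterlim_compose)
    qed
    show "AE x in lborel. norm (q m x) \<le> indicator (cball 0 (r + norm b)) x *\<^sub>R M" for m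
    proof (rule AE_I2)
      fix x
      show "norm (q m x) \<le> indicator (cball 0 (r + norm b)) x *\<^sub>R M"
      proof (cases "x \<in> cball 0 (r + norm b)")
        case True
        have d: "((\<lambda>t. h (x + t *\<^sub>R b)) has_real_derivative h' (x + s *\<^sub>R b) b) (at s)" for s
          using has_derivative_directional[OF deriv, of "x + s *\<^sub>R b" b]
            DERIV_shift[of "\<lambda>t. h (x + t *\<^sub>R b)" "h' (x + s *\<^sub>R b) b" 0 s]
          by (simp add: has_real_derivative_iff_has_vector_derivative algebra_simps)
        obtain z where "h (x + c m *\<^sub>R b) - h (x + 0 *\<^sub>R b) = (c m - 0) * h' (x + z *\<^sub>R b) b"
          using MVT2[OF c(1)[of m], of "\<lambda>t. h (x + t *\<^sub>R b)" "\<lambda>s. h' (x + s *\<^sub>R b) b"] d by blast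
        then have "q m x = h' (x + z *\<^sub>R b) b" using c(1)[of m] by (simp add: q_def)
        then show ?thesis using M(1) True by simp
      next
        case False
        then have n: "norm x > r + norm b" by simp
        have "norm (c m *\<^sub>R b) \<le> norm b" using c[of m] by (simp add: mult_left_le_one_le)
        moreover have "norm x - norm (c m *\<^sub>R b) \<le> norm (x + c m *\<^sub>R b)"
          by (metis norm_diff_ineq)
        ultimately have "x + c m *\<^sub>R b \<notin> K" "x \<notin> K" using r n
          by (smt (verit) norm_ge_zero)+
        then show ?thesis using K(2) M(2) by (simp add: q_def)
      qed
    qed
  qed
  then show ?thesis using q0 by (simp add: LIMSEQ_const_iff)
qed

text \<open>The hypotheses below give continuity of derivatives for one fixed direction at a time; the expansion in
  a basis transfers it to directions that vary with the point.\<close>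

lemma linear_eq_sum_Basis:
  fixes f :: "'a::euclidean_space \<Rightarrow> 'b::real_vector"
  assumes "linear f"
  shows "f v = (\<Sum>b\<in>Basis. (v \<bullet> b) *\<^sub>R f b)"
proof -
  have "f v = f (\<Sum>b\<in>Basis. (v \<bullet> b) *\<^sub>R b)" by (simp add: euclidean_representation)
  then show ?thesis using assms by (simp add: linear_sum linear_cmul)
qed

lemma continuous_on_linear_field:
  fixes V :: "'c::topological_space \<Rightarrow> 'a::euclidean_space"
    and D :: "'c \<Rightarrow> 'a \<Rightarrow> 'b::real_normed_vector"
  assumes "\<And>x. x \<in> S \<Longrightarrow> linear (D x)" "\<And>b. continuous_on S (\<lambda>x. D x b)" "continuous_on S V"
  shows "continuous_on S (\<lambda>x. D x (V x))"
proof -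
  have "continuous_on S (\<lambda>x. \<Sum>b\<in>Basis. (V x \<bullet> b) *\<^sub>R D x b)"
    by (intro continuous_intros assms)
  then show ?thesis
    by (rule continuous_on_eq) (rule linear_eq_sum_Basis[OF assms(1), symmetric])
qed

lemma set_integrable_continuous_zero_outside_compact:
  fixes f :: "'a::euclidean_space \<Rightarrow> 'b::euclidean_space"
  assumes "continuous_on S f" "compact K" "K \<subseteq> S" "\<And>x. x \<in> S \<Longrightarrow> x \<notin> K \<Longrightarrow> f x = 0"
  shows "set_integrable lborel S f"
proof -
  have "(\<lambda>x. indicator S x *\<^sub>R f x) = (\<lambda>x. indicator K x *\<^sub>R f x)"
    using assms(3,4) by (auto simp: indicator_def fun_eq_iff)
  then show ?thesis
    unfolding set_integrable_def
    using borel_integrable_compact[OF assms(2) continuous_on_subset[OF assms(1,3)]] by simp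
qed

text \<open>The field has divergence zero in the strong sense that each coefficient \<open>V \<bullet> b\<close> has no derivative
  along its own direction \<open>b\<close>. So \<open>Vg = \<Sum>\<^sub>b \<partial>\<^sub>b ((V \<bullet> b) g)\<close> term by term, and each term has integral
  zero.\<close>

lemma integral_divergence_free_field_eq_zero:
  fixes g :: "'a::euclidean_space \<Rightarrow> real" and V :: "'a \<Rightarrow> 'a"
  assumes "open \<Omega>"
    and deriv: "\<And>x. x \<in> \<Omega> \<Longrightarrow> (g has_derivative g' x) (at x)"
    and cont: "\<And>b. continuous_on \<Omega> (\<lambda>x. g' x b)"
    and K: "compact K" "K \<subseteq> \<Omega>" "\<And>x. x \<notin> K \<Longrightarrow> g x = 0"
    and V: "\<And>x b. b \<in> Basis \<Longrightarrow> ((\<lambda>x. V x \<bullet> b) has_derivative A b x) (at x)"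
    and V0: "\<And>x b. b \<in> Basis \<Longrightarrow> A b x b = 0"
  shows "set_integrable lborel \<Omega> (\<lambda>x. g' x (V x))" 
    and "(LINT x:\<Omega>|lborel. g' x (V x)) = 0"
proof -
  have Kc: "closed K" using K(1) by (rule compact_imp_closed)
  \<comment> \<open>Nothing is known about \<open>g'\<close> outside \<open>\<Omega>\<close>; since \<open>g\<close> vanishes off \<open>K\<close>, its derivative extends by zero.\<close>
  define D where "D x b = (if x \<in> K then g' x b else 0)" for x b
  have g'0: "g' x b = 0" if "x \<notin> K" "x \<in> \<Omega>" for x b
    using has_derivative_unique[OF deriv[OF that(2)] has_derivative_zero_outside_support[OF Kc that(1) K(3)]]
    by simp
  have D\<Omega>: "D x = g' x" if "x \<in> \<Omega>" for x using that g'0 by (auto simp: D_def)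
  have D: "(g has_derivative D x) (at x)" for x
  proof (cases "x \<in> \<Omega>")
    case True then show ?thesis using deriv D\<Omega> by simp
  next
    case False
    then have "x \<notin> K" using K by auto
    then show ?thesis using has_derivative_zero_outside_support[where g = g, OF Kc _ K(3)] by (simp add: D_def[abs_def])
  qed
  have contD: "continuous_on UNIV (\<lambda>x. D x b)" for b
  proof -
    have "continuous_on \<Omega> (\<lambda>x. D x b)" using cont[of b] D\<Omega> by (simp cong: continuous_on_cong)
    moreover have "continuous_on (- K) (\<lambda>x. D x b)"
      by (rule continuous_on_eq[of _ "\<lambda>x. 0"]) (auto simp: D_def)
    ultimately have "continuous_on (\<Omega> \<union> - K) (\<lambda>x. D x b)"
      using \<open>open \<Omega>\<close> Kc by (intro continuous_on_open_Un) auto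
    moreover have "\<Omega> \<union> - K = UNIV" using K(2) by auto
    ultimately show ?thesis by simp
  qed
  have contV: "continuous_on UNIV (\<lambda>x. V x \<bullet> b)" if "b \<in> Basis" for b
    by (intro has_derivative_continuous_on) (use V[OF that] has_derivative_at_withinI in blast)
  have expand: "D x (V x) = (\<Sum>b\<in>Basis. (V x \<bullet> b) * D x b)" for x
    using linear_eq_sum_Basis[OF has_derivative_linear[OF D[of x]], of "V x"] by (simp only: real_scaleR_def)
  have int: "integrable lborel (\<lambda>x. (V x \<bullet> b) * D x b)" if "b \<in> Basis" for b
  proof (rule integrable_continuous_zero_outside_compact[OF K(1)])
    show "continuous_on K (\<lambda>x. (V x \<bullet> b) * D x b)"
      by (intro continuous_on_mult continuous_on_subset[OF contD] continuous_on_subset[OF contV] that) auto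
  qed (simp add: D_def)
  have zero: "(\<integral>x. (V x \<bullet> b) * D x b \<partial>lborel) = 0" if b: "b \<in> Basis" for b
  proof -
    have d: "((\<lambda>x. (V x \<bullet> b) * g x) has_derivative (\<lambda>y. (V x \<bullet> b) * D x y + A b x y * g x)) (at x)" for x
      using has_derivative_mult[OF V[OF b] D] .
    have "(\<integral>x. (V x \<bullet> b) * D x b + A b x b * g x \<partial>lborel) = 0"
    proof (rule integral_directional_derivative_eq_zero[OF d _ K(1)])
      show "continuous_on UNIV (\<lambda>x. (V x \<bullet> b) * D x b + A b x b * g x)"
        using V0[OF b] contD contV[OF b] by (simp add: continuous_on_mult)
    qed (simp add: K(3))
    then show ?thesis using V0[OF b] by simp
  qed
  have ind: "(\<lambda>x. indicator \<Omega> x *\<^sub>R g' x (V x)) = (\<lambda>x. \<Sum>b\<in>Basis. (V x \<bullet> b) * D x b)"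
  proof
    fix x show "indicator \<Omega> x *\<^sub>R g' x (V x) = (\<Sum>b\<in>Basis. (V x \<bullet> b) * D x b)"
      unfolding expand[symmetric] using D\<Omega>[of x] K(2) g'0[of x] by (auto simp: indicator_def D_def)
  qed
  show "set_integrable lborel \<Omega> (\<lambda>x. g' x (V x))"
    unfolding set_integrable_def ind using int by auto
  show "(LINT x:\<Omega>|lborel. g' x (V x)) = 0"
    unfolding set_lebesgue_integral_def ind using int zero by (simp add: Bochner_Integration.integral_sum)
qed

section \<open>Homogeneity\<close>

lemma smooth_on_has_derivative:
  assumes "smooth_on S f" "x \<in> S"
  shows "(f has_derivative frechet_derivative f (at x)) (at x)"
proof -
  have "times_differentiable_on (Suc 0) S f" using assms by (simp add: smooth_on_def)
  then show ?thesis using assms(2) by (simp add: frechet_derivative_works)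
qed

lemma smooth_on_frechet_derivative:
  assumes "smooth_on S f"
  shows "smooth_on S (\<lambda>x. frechet_derivative f (at x) v)"
proof -
  have "times_differentiable_on (Suc m) S f" for m using assms by (simp only: smooth_on_def)
  then show ?thesis by (simp add: smooth_on_def)
qed

lemma smooth_on_imp_continuous_on: "smooth_on S f \<Longrightarrow> continuous_on S f"
  unfolding smooth_on_def by (metis times_differentiable_on.simps(1))

lemma dilation_eq_sum: "dilation wt c y = (\<Sum>k\<in>UNIV. (c ^ wt k * y $ k) *\<^sub>R axis k 1)"
  by (simp add: dilation_def vec_eq_iff sum_component axis_def if_distrib cong: if_cong)

lemma linear_dilation: "linear (dilation wt c)"
  by (rule linearI) (auto simp: dilation_def vec_eq_iff algebra_simps)

lemma dilation_axis: "dilation wt c (axis k 1) = c ^ wt k *\<^sub>R axis k 1"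
  by (simp add: dilation_def vec_eq_iff axis_def)

context stratified_group
begin

lemma wt_pos: "wt k \<ge> 1"
  using strata by (metis atLeastAtMost_iff rangeI)

lemma dilation_mult: "0 < c \<Longrightarrow> dilation wt c (x \<otimes> y) = dilation wt c x \<otimes> dilation wt c y"
  using dilation_automorphism[of c] carrier_UNIV by (simp add: iso_def hom_def)

text \<open>The identity is fixed by all dilations, and only the origin is.\<close>

lemma one_eq_zero: "\<one> = 0"
proof -
  have "dilation wt 2 \<in> hom G G" using dilation_automorphism[of 2] by (simp add: iso_def)
  then have "dilation wt 2 \<one> = \<one>" using hom_one[OF _ is_group is_group] by blast
  then have "2 ^ wt k * \<one> $ k = \<one> $ k" for k
    by (metis dilation_def vec_lambda_beta)
  moreover have "(2::real) ^ wt k \<noteq> 1" for k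
    using one_less_power[of "2::real" "wt k"] wt_pos[of k] by linarith
  ultimately show ?thesis by (simp add: vec_eq_iff)
qed

lemma mult_zero: "x \<otimes> 0 = x" "0 \<otimes> x = x"
  using carrier_UNIV r_one[of x] l_one[of x] unfolding one_eq_zero by auto

text \<open>To first order in \<open>c\<close> a dilation only sees the stratum of weight \<open>1\<close>.\<close>

lemma dilation_has_derivative_at_zero:
  "((\<lambda>c. dilation wt c y) has_vector_derivative first_stratum wt y) (at 0)"
proof -
  have p: "((\<lambda>c. c ^ wt k * y $ k) has_real_derivative first_stratum wt y $ k) (at 0)" for k
    using wt_pos[of k]
    by (auto intro!: derivative_eq_intros simp: first_stratum_def power_0_left)
  have "((\<lambda>c. \<Sum>k\<in>UNIV. (c ^ wt k * y $ k) *\<^sub>R axis k 1) has_vector_derivative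
      (\<Sum>k\<in>UNIV. first_stratum wt y $ k *\<^sub>R (axis k 1 :: real^'d))) (at 0)"
    using has_vector_derivative_scaleR[OF p has_vector_derivative_const]
    by (intro has_vector_derivative_sum) simp
  moreover have "(\<Sum>k\<in>UNIV. first_stratum wt y $ k *\<^sub>R axis k 1) = first_stratum wt y"
    by (simp add: vec_eq_iff sum_component axis_def if_distrib cong: if_cong)
  ultimately show ?thesis by (simp add: dilation_eq_sum)
qed

lemma dilation_zero: "dilation wt 0 y = 0"
proof -
  have "0 < wt k" for k using wt_pos[of k] by simp
  then show ?thesis by (simp add: dilation_def vec_eq_iff zero_power)
qed

abbreviation mult_pair where "mult_pair \<equiv> (\<lambda>(x, y). x \<otimes> y)"

text \<open>For \<open>c > 0\<close> the \<open>k\<close>-th coordinate of \<open>\<delta>\<^sub>c x \<otimes> \<delta>\<^sub>c y\<close> is \<open>c (x \<otimes> y)\<^sub>k\<close>. The derivative of the former at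
  \<open>c = 0\<close> is the differential \<open>D\<close> of the product at the identity, applied to \<open>(x', y')\<close>. So
  \<open>(x \<otimes> y)\<^sub>k = D(x', y')\<^sub>k\<close>, which is additive, and the cases \<open>y = 0\<close> and \<open>x = 0\<close> identify the two
  summands.\<close>

lemma first_stratum_mult:
  assumes k: "wt k = 1"
  shows "(x \<otimes> y) $ k = x $ k + y $ k"
proof -
  obtain D where D: "(mult_pair has_derivative D) (at (0, 0))"
    using smooth_on_has_derivative[OF smooth_mult] by blast
  have lin: "linear D" using D has_derivative_linear by blast
  have fo: "(x \<otimes> y) $ k = D (first_stratum wt x, first_stratum wt y) $ k" for x y
  proof -
    let ?w = "(first_stratum wt x, first_stratum wt y)"
    have "((\<lambda>c. (dilation wt c x, dilation wt c y)) has_derivative (\<lambda>h. h *\<^sub>R ?w)) (at 0)"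
      using has_derivative_Pair[OF dilation_has_derivative_at_zero[of x, unfolded has_vector_derivative_def]
          dilation_has_derivative_at_zero[of y, unfolded has_vector_derivative_def]]
      by simp
    then have "((\<lambda>c. mult_pair (dilation wt c x, dilation wt c y)) has_derivative (\<lambda>h. D (h *\<^sub>R ?w))) (at 0)"
      by (rule has_derivative_compose) (use D in \<open>simp add: dilation_zero\<close>)
    then have "((\<lambda>c. mult_pair (dilation wt c x, dilation wt c y) $ k) has_derivative (\<lambda>h. D (h *\<^sub>R ?w) $ k)) (at 0)"
      by (rule bounded_linear.has_derivative[OF bounded_linear_vec_nth])
    then have "((\<lambda>c. (dilation wt c x \<otimes> dilation wt c y) $ k) has_real_derivative D ?w $ k) (at 0)"
      using linear_cmul[OF lin] by (simp add: has_field_derivative_def mult.commute[of _ "D ?w $ k"] del: scaleR_Pair)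
    \<comment> \<open>Homogeneity holds for \<open>c \<ge> 0\<close> only, so the derivatives are compared from the right.\<close>
    then have 1: "((\<lambda>c. (dilation wt c x \<otimes> dilation wt c y) $ k) has_real_derivative D ?w $ k) (at 0 within {0..})"
      by (rule DERIV_subset) simp
    have eq: "(dilation wt c x \<otimes> dilation wt c y) $ k = c * (x \<otimes> y) $ k" if "c \<in> {0..}" for c
    proof (cases "c = 0")
      case True
      then show ?thesis by (simp add: dilation_zero mult_zero)
    next
      case False
      then have "(dilation wt c x \<otimes> dilation wt c y) $ k = dilation wt c (x \<otimes> y) $ k"
        using that by (simp add: dilation_mult)
      then show ?thesis by (simp add: dilation_def k)
    qed
    have 2: "((\<lambda>c. c * (x \<otimes> y) $ k) has_real_derivative D ?w $ k) (at 0 within {0..})"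
      by (rule has_field_derivative_transform_within[OF 1, of 1]) (use eq in auto)
    have 3: "((\<lambda>c. c * (x \<otimes> y) $ k) has_real_derivative (x \<otimes> y) $ k) (at 0 within {0..})"
      by (auto intro!: derivative_eq_intros)
    show ?thesis
      using vector_derivative_unique_within[of 0 "{0::real..}"] 2 3
      by (simp add: has_real_derivative_iff_has_vector_derivative at_within_Ici_at_right)
  qed
  have fs0: "first_stratum wt 0 = 0" by (simp add: first_stratum_def vec_eq_iff)
  have "D (first_stratum wt x, first_stratum wt y) = D (first_stratum wt x, 0) + D (0, first_stratum wt y)"
    using linear_add[OF lin, of "(first_stratum wt x, 0)" "(0, first_stratum wt y)"] by simp
  then show ?thesis
    using fo[of x y] fo[of x 0] fo[of 0 y] by (simp add: mult_zero fs0)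
qed

lemma first_stratum_inv:
  assumes "wt k = 1"
  shows "(inv x) $ k = - x $ k"
proof -
  have "x \<otimes> inv x = 0" using carrier_UNIV one_eq_zero by simp
  then have "x $ k + (inv x) $ k = 0" using first_stratum_mult[OF assms, of x "inv x"] by simp
  then show ?thesis by simp
qed

lemma first_stratum_mult_inv:
  "first_stratum wt (x \<otimes> inv y) = first_stratum wt x - first_stratum wt y"
  by (simp add: first_stratum_def vec_eq_iff first_stratum_mult first_stratum_inv)

lemma left_translation_has_derivative:
  "((\<lambda>z. y \<otimes> z) has_derivative (\<lambda>h. frechet_derivative mult_pair (at (y, z)) (0, h))) (at z)"
proof -
  have "((\<lambda>z. (y, z)) has_derivative (\<lambda>h. (0, h))) (at z)"
    by (auto intro!: derivative_eq_intros)
  then have "((\<lambda>z. mult_pair (y, z)) has_derivative (\<lambda>h. frechet_derivative mult_pair (at (y, z)) (0, h))) (at z)"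
    by (rule has_derivative_compose) (rule smooth_on_has_derivative[OF smooth_mult UNIV_I])
  then show ?thesis by simp
qed

text \<open>The generator as a derivative of the product in both variables jointly; in this form its smoothness in
  \<open>y\<close> is inherited from the product.\<close>

lemma jacobian_generator_eq:
  "jacobian_generator G k y = frechet_derivative mult_pair (at (y, 0)) (0, axis k 1)"
  unfolding jacobian_generator_def
  using frechet_derivative_at[OF left_translation_has_derivative[of y 0]] by (metis)

lemma jacobian_generator_first_stratum:
  assumes "wt l = 1"
  shows "jacobian_generator G k y $ l = axis k 1 $ l"
proof -
  have "((\<lambda>z. (y \<otimes> z) $ l) has_derivative (\<lambda>h. frechet_derivative mult_pair (at (y, 0)) (0, h) $ l)) (at 0)"
    by (rule bounded_linear.has_derivative[OF bounded_linear_vec_nth left_translation_has_derivative])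
  moreover have "((\<lambda>z. (y \<otimes> z) $ l) has_derivative (\<lambda>h. h $ l)) (at 0)"
    unfolding first_stratum_mult[OF assms]
    by (auto intro!: derivative_eq_intros bounded_linear.has_derivative[OF bounded_linear_vec_nth])
  ultimately have "(\<lambda>h. frechet_derivative mult_pair (at (y, 0)) (0, h) $ l) = (\<lambda>h. h $ l)"
    by (rule has_derivative_unique)
  then show ?thesis unfolding jacobian_generator_eq by meson
qed

text \<open>Differentiate \<open>\<delta>\<^sub>c (y \<otimes> z) = \<delta>\<^sub>c y \<otimes> \<delta>\<^sub>c z\<close> in \<open>z\<close> at the identity.\<close>

lemma jacobian_generator_dilation:
  assumes "0 < c"
  shows "c ^ wt k *\<^sub>R jacobian_generator G k (dilation wt c y) = dilation wt c (jacobian_generator G k y)"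
proof -
  let ?D = "\<lambda>y. \<lambda>h. frechet_derivative mult_pair (at (y, 0)) (0, h)"
  have bl: "(dilation wt c has_derivative dilation wt c) (at z)" for z
    using linear_dilation[of wt c] linear_conv_bounded_linear bounded_linear_imp_has_derivative by blast
  have "((\<lambda>z. dilation wt c (y \<otimes> z)) has_derivative (\<lambda>h. dilation wt c (?D y h))) (at 0)"
    by (rule has_derivative_compose[OF left_translation_has_derivative bl])
  moreover have "((\<lambda>z. dilation wt c y \<otimes> dilation wt c z) has_derivative
      (\<lambda>h. ?D (dilation wt c y) (dilation wt c h))) (at 0)"
    by (rule has_derivative_compose[OF bl])
      (use left_translation_has_derivative[of "dilation wt c y" 0] in \<open>simp add: linear_0[OF linear_dilation]\<close>)
  ultimately have "(\<lambda>h. dilation wt c (?D y h)) = (\<lambda>h. ?D (dilation wt c y) (dilation wt c h))"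
    unfolding dilation_mult[OF assms] by (rule has_derivative_unique)
  then have "dilation wt c (?D y (axis k 1)) = ?D (dilation wt c y) (c ^ wt k *\<^sub>R axis k 1)"
    by (metis dilation_axis)
  also have "linear (?D (dilation wt c y))"
    using left_translation_has_derivative has_derivative_linear by blast
  then have "?D (dilation wt c y) (c ^ wt k *\<^sub>R axis k 1) = c ^ wt k *\<^sub>R ?D (dilation wt c y) (axis k 1)"
    by (rule linear_cmul)
  finally show ?thesis by (simp add: jacobian_generator_eq)
qed

lemma jacobian_generator_has_derivative:
  obtains A where "\<And>y. (jacobian_generator G k has_derivative A y) (at y)"
    and "\<And>h. continuous_on UNIV (\<lambda>y. A y h)"
proof -
  let ?M = "\<lambda>p. frechet_derivative mult_pair (at p) (0, axis k 1)"
  have M: "smooth_on UNIV ?M" by (rule smooth_on_frechet_derivative[OF smooth_mult])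
  have "((\<lambda>y. (y, 0)) has_derivative (\<lambda>h. (h, 0))) (at y)" for y :: "real^'d"
    by (auto intro!: derivative_eq_intros)
  then have "((\<lambda>y. ?M (y, 0)) has_derivative (\<lambda>h. frechet_derivative ?M (at (y, 0)) (h, 0))) (at y)" for y
    by (rule has_derivative_compose) (rule smooth_on_has_derivative[OF M UNIV_I])
  moreover have "(\<lambda>y. ?M (y, 0)) = jacobian_generator G k"
    using jacobian_generator_eq by auto
  moreover have "continuous_on UNIV (\<lambda>y. frechet_derivative ?M (at (y, 0)) (h, 0))" for h
    by (rule continuous_on_compose2[OF smooth_on_imp_continuous_on[OF smooth_on_frechet_derivative[OF M]]])
      (auto intro!: continuous_intros)
  ultimately show ?thesis by (intro that) auto
qed

text \<open>The \<open>l\<close>-th coefficient of \<open>X\<^sub>k\<close> is homogeneous of degree \<open>wt l - 1\<close>, and differentiating along a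
  coordinate of weight \<open>wt l\<close> lowers the degree to \<open>-1\<close>. A function that is continuous at the origin and
  homogeneous of degree \<open>-1\<close> vanishes: its value at \<open>y\<close> is \<open>c\<close> times its value at \<open>\<delta>\<^sub>c y\<close>, which tends
  to \<open>0\<close> with \<open>c\<close>.\<close>

lemma jacobian_generator_coefficient:
  assumes "wt k = 1" and A: "\<And>y. (jacobian_generator G k has_derivative A y) (at y)"
    and cont: "\<And>h. continuous_on UNIV (\<lambda>y. A y h)"
  shows "A y (axis l 1) $ l = 0"
proof -
  let ?e = "axis l 1 :: real^'d"
  have scal: "A y ?e $ l = c * A (dilation wt c y) ?e $ l" if c: "0 < c" for c
  proof -
    have bl: "(dilation wt c has_derivative dilation wt c) (at z)" for z
      using linear_dilation[of wt c] linear_conv_bounded_linear bounded_linear_imp_has_derivative by blast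
    have "((\<lambda>y. dilation wt c (jacobian_generator G k y)) has_derivative (\<lambda>h. dilation wt c (A y h))) (at y)"
      by (rule has_derivative_compose[OF A bl])
    moreover have "((\<lambda>y. c *\<^sub>R jacobian_generator G k (dilation wt c y)) has_derivative
        (\<lambda>h. c *\<^sub>R A (dilation wt c y) (dilation wt c h))) (at y)"
      by (rule has_derivative_scaleR_right[OF has_derivative_compose[OF bl A]])
    moreover have "(\<lambda>y. c *\<^sub>R jacobian_generator G k (dilation wt c y)) = (\<lambda>y. dilation wt c (jacobian_generator G k y))"
      using jacobian_generator_dilation[OF c, of k] assms(1) by simp
    ultimately have "(\<lambda>h. dilation wt c (A y h)) = (\<lambda>h. c *\<^sub>R A (dilation wt c y) (dilation wt c h))"
      using has_derivative_unique by metis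
    then have "dilation wt c (A y ?e) = c *\<^sub>R A (dilation wt c y) (c ^ wt l *\<^sub>R ?e)"
      by (metis dilation_axis)
    also have "A (dilation wt c y) (c ^ wt l *\<^sub>R ?e) = c ^ wt l *\<^sub>R A (dilation wt c y) ?e"
      using A has_derivative_linear linear_cmul by blast
    finally have "dilation wt c (A y ?e) $ l = (c *\<^sub>R c ^ wt l *\<^sub>R A (dilation wt c y) ?e) $ l" by simp
    then have "c ^ wt l * A y ?e $ l = c ^ wt l * (c * A (dilation wt c y) ?e $ l)"
      by (simp add: dilation_def)
    then show ?thesis using c by simp
  qed
  have "((\<lambda>c. dilation wt c y) \<longlongrightarrow> dilation wt 0 y) (at_right 0)"
    using has_vector_derivative_continuous[OF dilation_has_derivative_at_zero]
    by (metis isCont_def filterlim_at_split)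
  then have "((\<lambda>c. A (dilation wt c y) ?e) \<longlongrightarrow> A (dilation wt 0 y) ?e) (at_right 0)"
    using cont[of ?e] by (intro isCont_tendsto_compose[where g = "\<lambda>y. A y ?e"])
      (simp_all add: continuous_on_eq_continuous_at)
  then have "((\<lambda>c. c * A (dilation wt c y) ?e $ l) \<longlongrightarrow> 0 * A (dilation wt 0 y) ?e $ l) (at_right 0)"
    by (intro tendsto_mult tendsto_vec_nth tendsto_ident_at)
  moreover have "\<forall>\<^sub>F c in at_right 0. c * A (dilation wt c y) ?e $ l = A y ?e $ l"
    using eventually_at_right_less[of 0] by eventually_elim (use scal in simp)
  ultimately have "((\<lambda>c::real. A y ?e $ l) \<longlongrightarrow> 0) (at_right 0)"
    by (simp add: tendsto_cong)
  then show ?thesis by (simp add: tendsto_const_iff)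
qed

end

section \<open>The square of the particle distance\<close>

text \<open>Summing over all ordered pairs counts every unordered pair twice and the diagonal contributes nothing.\<close>

lemma sum_pairs_less_square_diff:
  fixes f :: "'n::{finite,linorder} \<Rightarrow> real"
  shows "(\<Sum>(i, j) \<in> {(i, j). i < j}. (f i - f j)\<^sup>2) = real CARD('n) * (\<Sum>i\<in>UNIV. (f i)\<^sup>2) - (\<Sum>i\<in>UNIV. f i)\<^sup>2"
proof -
  let ?F = "\<lambda>(i, j). (f i - f j)\<^sup>2"
  let ?L = "{(i, j). i < (j::'n)}" and ?U = "{(i, j). j < (i::'n)}" and ?E = "{(i, j). i = (j::'n)}"
  have "UNIV = ?L \<union> ?U \<union> ?E" by auto
  then have "sum ?F UNIV = sum ?F (?L \<union> ?U \<union> ?E)" by simp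
  also have "\<dots> = sum ?F ?L + sum ?F ?U + sum ?F ?E"
    by (subst sum.union_disjoint, auto)+
  also have "sum ?F ?E = 0" by (intro sum.neutral) auto
  also have "sum ?F ?U = sum ?F ?L"
    by (rule sum.reindex_bij_witness[of _ prod.swap prod.swap]) (auto simp: power2_commute)
  finally have "2 * sum ?F ?L = sum ?F (UNIV \<times> UNIV)" by simp
  also have "\<dots> = (\<Sum>i\<in>UNIV. \<Sum>j\<in>UNIV. (f i - f j)\<^sup>2)" by (simp add: sum.cartesian_product)
  also have "\<dots> = (\<Sum>i\<in>UNIV. \<Sum>j\<in>UNIV. (f i)\<^sup>2 + (f j)\<^sup>2 - 2 * (f i * f j))"
    by (simp add: power2_diff mult.assoc)
  also have "\<dots> = 2 * (real CARD('n) * (\<Sum>i\<in>UNIV. (f i)\<^sup>2)) - 2 * (\<Sum>i\<in>UNIV. f i)\<^sup>2"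
    by (simp add: sum.distrib sum_subtractf sum_distrib_left[symmetric] power2_eq_square sum_product)
  finally show ?thesis by simp
qed

text \<open>Up to the factor \<open>n\<close>, the displacement of the \<open>i\<close>-th particle from the centre of mass; it is also half
  the partial derivative of \<open>\<rho>\<^sup>2\<close> in the coordinate \<open>x\<^sub>i\<^sub>k\<close>.\<close>

definition deviation :: "'n \<Rightarrow> 'd \<Rightarrow> real^'d^'n \<Rightarrow> real" where
  "deviation i k x = real CARD('n) * x $ i $ k - (\<Sum>j\<in>UNIV. x $ j $ k)"

text \<open>This is \<open>\<rho>\<^sup>2\<close> (\<open>spread_eq_sum_pairs\<close>), written without reference to an order on the particles, which makes
  it easy to differentiate.\<close>

definition spread :: "('d \<Rightarrow> nat) \<Rightarrow> real^'d^'n \<Rightarrow> real" where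
  "spread wt x =
     (\<Sum>k | wt k = 1. real CARD('n) * (\<Sum>i\<in>UNIV. (x $ i $ k)\<^sup>2) - (\<Sum>i\<in>UNIV. x $ i $ k)\<^sup>2)"

lemma bounded_linear_coordinate: "bounded_linear (\<lambda>x :: real^'d^'n. x $ i $ k)"
  by (rule bounded_linear_compose[OF bounded_linear_vec_nth bounded_linear_vec_nth])

lemma bounded_linear_deviation: "bounded_linear (deviation i k :: real^'d^'n \<Rightarrow> real)"
  unfolding deviation_def[abs_def]
  by (intro bounded_linear_sub bounded_linear_sum bounded_linear_const_mult bounded_linear_coordinate)

lemma sum_deviation_square:
  "(\<Sum>i\<in>UNIV. \<Sum>k | wt k = 1. (deviation i k x)\<^sup>2) = real CARD('n) * spread wt (x :: real^'d^'n)"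
proof -
  have "(\<Sum>i\<in>UNIV. (deviation i k x)\<^sup>2)
      = real CARD('n) * (real CARD('n) * (\<Sum>i\<in>UNIV. (x $ i $ k)\<^sup>2) - (\<Sum>i\<in>UNIV. x $ i $ k)\<^sup>2)" for k
  proof -
    let ?n = "real CARD('n)" and ?S = "\<Sum>i\<in>UNIV. x $ i $ k"
    have "(deviation i k x)\<^sup>2 = ?n\<^sup>2 * (x $ i $ k)\<^sup>2 - 2 * ?n * ?S * x $ i $ k + ?S\<^sup>2" for i
      unfolding deviation_def by algebra
    then have "(\<Sum>i\<in>UNIV. (deviation i k x)\<^sup>2) = ?n\<^sup>2 * (\<Sum>i\<in>UNIV. (x $ i $ k)\<^sup>2) - 2 * ?n * ?S * ?S + ?n * ?S\<^sup>2"
      by (simp add: sum.distrib sum_subtractf sum_distrib_left)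
    then show ?thesis by algebra
  qed
  then show ?thesis by (subst sum.swap) (simp add: spread_def sum_distrib_left)
qed

lemma spread_has_derivative:
  fixes x :: "real^'d^'n"
  shows "(spread wt has_derivative (\<lambda>b. 2 * (\<Sum>i\<in>UNIV. \<Sum>k | wt k = 1. deviation i k x * b $ i $ k))) (at x)"
proof -
  have c: "((\<lambda>x :: real^'d^'n. x $ i $ k) has_derivative (\<lambda>b. b $ i $ k)) F" for i k F
    by (rule bounded_linear_imp_has_derivative[OF bounded_linear_coordinate])
  have "(spread wt has_derivative (\<lambda>b. \<Sum>k | wt k = 1. real CARD('n) * (\<Sum>i\<in>UNIV. 2 * (b $ i $ k * x $ i $ k))
      - 2 * ((\<Sum>i\<in>UNIV. b $ i $ k) * (\<Sum>i\<in>UNIV. x $ i $ k)))) (at x)"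
    unfolding spread_def[abs_def] by (auto intro!: derivative_eq_intros c simp: mult_ac)
  moreover have "(\<Sum>k | wt k = 1. real CARD('n) * (\<Sum>i\<in>UNIV. 2 * (b $ i $ k * x $ i $ k))
      - 2 * ((\<Sum>i\<in>UNIV. b $ i $ k) * (\<Sum>i\<in>UNIV. x $ i $ k)))
    = 2 * (\<Sum>i\<in>UNIV. \<Sum>k | wt k = 1. deviation i k x * b $ i $ k)" for b :: "real^'d^'n"
    by (subst sum.swap)
      (simp add: deviation_def algebra_simps sum_distrib_left sum_distrib_right sum_subtractf,
        intro sum.cong refl sum.swap)
  ultimately show ?thesis by simp
qed

lemma norm_first_stratum_square: "(norm (first_stratum wt y))\<^sup>2 = (\<Sum>k | wt k = 1. (y $ k)\<^sup>2)"
proof -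
  have "(norm (first_stratum wt y))\<^sup>2 = (\<Sum>k\<in>UNIV. if wt k = 1 then (y $ k)\<^sup>2 else 0)"
    unfolding power2_norm_eq_inner by (auto simp: inner_vec_def first_stratum_def power2_eq_square intro!: sum.cong)
  then show ?thesis by (simp add: sum.If_cases)
qed

lemma first_stratum_diff: "first_stratum wt (x - y) = first_stratum wt x - first_stratum wt y"
  by (simp add: first_stratum_def vec_eq_iff)

lemma spread_eq_sum_pairs:
  fixes x :: "real^'d^('n::{finite,linorder})"
  shows "spread wt x =
    (\<Sum>(i, j) \<in> {(i, j). i < j}. (norm (first_stratum wt (x $ i) - first_stratum wt (x $ j)))\<^sup>2)"
proof -
  have "spread wt x = (\<Sum>k | wt k = 1. \<Sum>(i, j) \<in> {(i, j). i < j}. (x $ i $ k - x $ j $ k)\<^sup>2)"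
    unfolding spread_def sum_pairs_less_square_diff ..
  also have "\<dots> = (\<Sum>(i, j) \<in> {(i, j). i < j}. \<Sum>k | wt k = 1. (x $ i $ k - x $ j $ k)\<^sup>2)"
    by (subst sum.swap) (simp add: case_prod_beta)
  finally show ?thesis
    by (simp add: norm_first_stratum_square flip: first_stratum_diff)
qed

lemma spread_nonneg: "0 \<le> spread wt (x :: real^'d^('n::{finite,linorder}))"
  unfolding spread_eq_sum_pairs by (intro sum_nonneg) auto

lemma spread_pos:
  fixes x :: "real^'d^('n::{finite,linorder})"
  assumes "first_stratum wt (x $ i) \<noteq> first_stratum wt (x $ j)" "i < j"
  shows "0 < spread wt x"
  unfolding spread_eq_sum_pairs using assms by (intro sum_pos2[of _ "(i, j)"]) auto

text \<open>The factor \<open>R\<^sup>-\<^sup>a\<close> is pulled out so that it cancels against the weight \<open>\<rho>\<^sup>4\<^sup>\<alpha>\<close>.\<close>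

lemma powr_weighted_gradient:
  fixes u :: "'a::real_normed_vector \<Rightarrow> 'b::real_normed_vector" and R :: "'a \<Rightarrow> real"
  assumes u: "(u has_derivative u') (at x)" and R: "(R has_derivative R') (at x)" and pos: "0 < R x"
  shows "((\<lambda>y. R y powr (- a) *\<^sub>R u y) has_derivative
      (\<lambda>b. R x powr (- a) *\<^sub>R (u' b - (a * R' b / R x) *\<^sub>R u x))) (at x)"
proof -
  have "((\<lambda>t. t powr (- a)) has_derivative (\<lambda>h. (- a * R x powr (- a - 1)) * h)) (at (R x))"
    using has_real_derivative_powr[OF pos, of "- a"] by (simp only: has_field_derivative_def)
  from has_derivative_compose[OF R this]
  have p: "((\<lambda>y. R y powr (- a)) has_derivative (\<lambda>b. (- a * R x powr (- a - 1)) * R' b)) (at x)" .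
  have "R x powr (- a - 1) = R x powr (- a) / R x"
    using pos by (simp add: powr_diff)
  then show ?thesis
    using has_derivative_scaleR[OF p u] by (simp add: algebra_simps)
qed

text \<open>The algebra of the identity, at one point and for one field \<open>X\<close>, with \<open>U = u\<close>, \<open>W = Xu\<close>, \<open>XR = 2T\<close> and
  \<open>XT = m\<close>. The first summand is \<open>R\<^sup>2\<^sup>a \<bar>X(R\<^sup>-\<^sup>a u)\<bar>\<^sup>2\<close>, the second is \<open>X(2 a \<bar>u\<bar>\<^sup>2 T/R)\<close>, and the third is what
  remains after this total derivative has absorbed the cross term.\<close>

lemma hardy_expansion:
  fixes U W :: "'b::real_inner"
  assumes "0 < R"
  shows "(norm W)\<^sup>2 = (norm (W - (a * (2 * T) / R) *\<^sub>R U))\<^sup>2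
    + 2 * a * (2 * (U \<bullet> W) * T / R + (U \<bullet> U) * (m / R - T * (2 * T) / R\<^sup>2))
    + (U \<bullet> U) * ((4 * a - 4 * a\<^sup>2) * T\<^sup>2 / R\<^sup>2 - 2 * a * m / R)"
  using assms unfolding power2_norm_eq_inner
  by (simp add: inner_diff_left inner_diff_right inner_commute field_simps power2_eq_square)

section \<open>The horizontal fields on the configuration space\<close>

lemma bounded_linear_axis: "bounded_linear (axis i :: 'a::euclidean_space \<Rightarrow> 'a^'n)"
  unfolding linear_conv_bounded_linear[symmetric] by (rule linearI) (auto simp: axis_def vec_eq_iff)

definition lifted_field :: "(real^'d) monoid \<Rightarrow> 'n \<Rightarrow> 'd \<Rightarrow> real^'d^'n \<Rightarrow> real^'d^'n" where
  "lifted_field G i k x = axis i (jacobian_generator G k (x $ i))"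

text \<open>Freezing all variables but \<open>x\<^sub>i\<close> and applying \<open>X\<^sub>k\<close> is the same as differentiating along a vector field
  on the whole configuration space, which is where the integration by parts takes place.\<close>

lemma particle_field_eq:
  assumes "(u has_derivative u') (at x)"
  shows "particle_field G i k u x = u' (lifted_field G i k x)"
proof -
  have eq: "(\<chi> j. if j = i then y else x $ j) = (x - axis i (x $ i)) + axis i y" for y
    by (simp add: vec_eq_iff axis_def)
  have "((\<lambda>y. (x - axis i (x $ i)) + axis i y) has_derivative axis i) (at (x $ i))"
    using has_derivative_add[OF has_derivative_const bounded_linear_imp_has_derivative[OF bounded_linear_axis]]
    by simp
  then have "((\<lambda>y. u ((x - axis i (x $ i)) + axis i y)) has_derivative (\<lambda>h. u' (axis i h))) (at (x $ i))"
    by (rule has_derivative_compose) (use assms in simp)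
  from frechet_derivative_at[OF this] show ?thesis
    unfolding particle_field_def vf_apply_def lifted_field_def eq by metis
qed

lemma norm_horizontal_gradient_square:
  assumes "(u has_derivative u') (at x)"
  shows "(norm (horizontal_gradient G wt u x))\<^sup>2
    = (\<Sum>i\<in>UNIV. \<Sum>k | wt k = 1. (norm (u' (lifted_field G i k x)))\<^sup>2)"
proof -
  have "(norm (horizontal_gradient G wt u x))\<^sup>2
    = (\<Sum>i\<in>UNIV. \<Sum>k\<in>UNIV. if wt k = 1 then (norm (u' (lifted_field G i k x)))\<^sup>2 else 0)"
    unfolding power2_norm_eq_inner
    by (auto simp: inner_vec_def horizontal_gradient_def particle_field_eq[OF assms] intro!: sum.cong)
  then show ?thesis by (simp add: sum.If_cases)
qed

context stratified_group
begin

lemma rho_eq: "rho G wt x = sqrt (spread wt x)"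
  unfolding rho_def spread_eq_sum_pairs first_stratum_mult_inv ..

text \<open>The coefficient of the lifted field at particle \<open>j\<close> is zero unless \<open>j = i\<close>, and then it is a coefficient of
  \<open>X\<^sub>k\<close>, which does not vary along its own coordinate.\<close>

lemma lifted_field_divergence_free:
  assumes "wt k = 1"
  obtains A where "\<And>x b. ((\<lambda>x :: real^'d^'n. lifted_field G i k x \<bullet> b) has_derivative A b x) (at x)"
    and "\<And>x b. b \<in> Basis \<Longrightarrow> A b x b = 0"
proof -
  obtain A where A: "\<And>y. (jacobian_generator G k has_derivative A y) (at y)"
    "\<And>h. continuous_on UNIV (\<lambda>y. A y h)"
    using jacobian_generator_has_derivative by blast
  let ?B = "\<lambda>b x h. axis i (A (x $ i) (h $ i)) \<bullet> b"
  show ?thesis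
  proof (rule that[of ?B])
    fix x b :: "real^'d^'n"
    have "((\<lambda>x :: real^'d^'n. jacobian_generator G k (x $ i)) has_derivative (\<lambda>h. A (x $ i) (h $ i))) (at x)"
      by (rule has_derivative_compose[OF bounded_linear_imp_has_derivative[OF bounded_linear_vec_nth] A(1)])
    from bounded_linear.has_derivative[OF bounded_linear_compose[OF bounded_linear_inner_left bounded_linear_axis] this]
    show "((\<lambda>x. lifted_field G i k x \<bullet> b) has_derivative ?B b x) (at x)"
      by (simp add: lifted_field_def)
    assume "b \<in> Basis"
    then obtain j l where b: "b = axis j (axis l 1)" by (auto simp: Basis_vec_def)
    have A0: "A (x $ i) 0 = 0" using A(1) has_derivative_linear linear_0 by blast
    show "?B b x b = 0"
    proof (cases "j = i")
      case True
      then show ?thesis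
        using jacobian_generator_coefficient[OF assms A, of "x $ i" l] by (simp add: b inner_axis_axis inner_axis)
    next
      case False
      then have "b $ i = 0" by (simp add: b axis_def)
      then show ?thesis using A0 False by (simp add: b inner_axis_axis)
    qed
  qed
qed

lemma lifted_field_coordinate:
  assumes "wt l = 1"
  shows "lifted_field G i k x $ j $ l = (if j = i \<and> l = k then 1 else 0)"
  using jacobian_generator_first_stratum[OF assms, of k "x $ i"]
  by (auto simp: lifted_field_def axis_def)

lemma deviation_lifted_field:
  assumes "wt k = 1"
  shows "deviation i k (lifted_field G i k x :: real^'d^'n) = real CARD('n) - 1"
  by (simp add: deviation_def lifted_field_coordinate[OF assms])

text \<open>The left-hand side is half the derivative of \<open>spread\<close> along the lifted field.\<close>

lemma sum_deviation_lifted_field: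
  assumes "wt k = 1"
  shows "(\<Sum>j\<in>UNIV. \<Sum>l | wt l = 1. deviation j l x * lifted_field G i k x $ j $ l) = deviation i k x"
proof -
  have "(\<Sum>l | wt l = 1. deviation j l x * lifted_field G i k x $ j $ l) = (if j = i then deviation i k x else 0)" for j
  proof -
    have "(\<Sum>l | wt l = 1. deviation j l x * lifted_field G i k x $ j $ l)
      = (\<Sum>l | wt l = 1. if l = k then (if j = i then deviation i k x else 0) else 0)"
      by (intro sum.cong) (auto simp: lifted_field_coordinate)
    then show ?thesis using assms by simp
  qed
  then show ?thesis by simp
qed

lemma continuous_lifted_field: "continuous_on UNIV (lifted_field G i k)"
proof -
  obtain A where "\<And>y. (jacobian_generator G k has_derivative A y) (at y)"
    using jacobian_generator_has_derivative by blast
  then have "continuous_on UNIV (jacobian_generator G k)"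
    by (intro has_derivative_continuous_on) (use has_derivative_at_withinI in blast)
  then have "continuous_on UNIV (\<lambda>x. jacobian_generator G k (x $ i))"
    by (rule continuous_on_compose2) (auto intro!: continuous_intros)
  then show ?thesis unfolding lifted_field_def[abs_def]
    by (rule bounded_linear.continuous_on[OF bounded_linear_axis])
qed

end

section \<open>The Hardy identity\<close>

context stratified_group
begin

text \<open>Here the value of the exponent enters: \<open>(n - 1) N = 2 - 4 a\<close> turns
  \<open>4 a - 4 a\<^sup>2 - 2 a (n - 1) N\<close> into \<open>4 a\<^sup>2\<close>.\<close>

lemma sum_hardy_remainder:
  fixes x :: "real^'d^('n::{finite,linorder})"
  assumes a: "4 * a = 2 - (real CARD('n) - 1) * real (card {k. wt k = 1})" and pos: "0 < spread wt x"
  shows "(\<Sum>i\<in>UNIV. \<Sum>k | wt k = 1.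
        (4 * a - 4 * a\<^sup>2) * (deviation i k x)\<^sup>2 / (spread wt x)\<^sup>2 - 2 * a * (real CARD('n) - 1) / spread wt x)
      = 4 * real CARD('n) * a\<^sup>2 / spread wt x"
proof -
  let ?n = "real CARD('n)" and ?N = "real (card {k. wt k = 1})" and ?R = "spread wt x"
  have "(\<Sum>i\<in>UNIV. \<Sum>k | wt k = 1. (4 * a - 4 * a\<^sup>2) * (deviation i k x)\<^sup>2 / ?R\<^sup>2 - 2 * a * (?n - 1) / ?R)
    = (4 * a - 4 * a\<^sup>2) * (\<Sum>i\<in>UNIV. \<Sum>k | wt k = 1. (deviation i k x)\<^sup>2) / ?R\<^sup>2 - ?n * (?N * (2 * a * (?n - 1) / ?R))"
    by (simp add: sum_subtractf sum_distrib_left sum_divide_distrib)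
  also have "\<dots> = (4 * a - 4 * a\<^sup>2) * (?n * ?R) / ?R\<^sup>2 - ?n * (2 * a * ((?n - 1) * ?N) / ?R)"
    unfolding sum_deviation_square by (simp add: algebra_simps)
  also have "(?n - 1) * ?N = 2 - 4 * a" using a by simp
  also have "(4 * a - 4 * a\<^sup>2) * (?n * ?R) / ?R\<^sup>2 - ?n * (2 * a * (2 - 4 * a) / ?R) = 4 * ?n * a\<^sup>2 / ?R"
    using pos by (simp add: field_simps power2_eq_square)
  finally show ?thesis .
qed

text \<open>The identity for a function that is merely continuously differentiable with compact support in a set where
  the particles do not all have the same first stratum coordinates.\<close>

lemma hardy_identity:
  fixes u :: "real^'d^('n::{finite,linorder}) \<Rightarrow> complex"
  assumes "open \<Omega>"
    and pos: "\<And>x. x \<in> \<Omega> \<Longrightarrow> 0 < spread wt x"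
    and u: "\<And>x. x \<in> \<Omega> \<Longrightarrow> (u has_derivative u' x) (at x)"
    and cont: "\<And>b. continuous_on \<Omega> (\<lambda>x. u' x b)"
    and K: "compact K" "K \<subseteq> \<Omega>" "\<And>x. x \<notin> K \<Longrightarrow> u x = 0"
    and a: "4 * a = 2 - (real CARD('n) - 1) * real (card {k. wt k = 1})"
  defines "v \<equiv> \<lambda>y. rho G wt y powr (- 2 * a) *\<^sub>R u y"
  shows "set_integrable lborel \<Omega> (\<lambda>x. (norm (horizontal_gradient G wt u x))\<^sup>2)" (is ?I1)
    and "set_integrable lborel \<Omega> (\<lambda>x. (norm (u x))\<^sup>2 / (rho G wt x)\<^sup>2)" (is ?I2)
    and "set_integrable lborel \<Omega> (\<lambda>x. (norm (horizontal_gradient G wt v x))\<^sup>2 * rho G wt x powr (4 * a))"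
      (is ?I3)
    and "(LINT x:\<Omega>|lborel. (norm (horizontal_gradient G wt u x))\<^sup>2)
      = 4 * real CARD('n) * a\<^sup>2 * (LINT x:\<Omega>|lborel. (norm (u x))\<^sup>2 / (rho G wt x)\<^sup>2)
        + (LINT x:\<Omega>|lborel. (norm (horizontal_gradient G wt v x))\<^sup>2 * rho G wt x powr (4 * a))"
      (is ?E)
proof -
  let ?R = "spread wt :: real^'d^('n::{finite,linorder}) \<Rightarrow> real"
  let ?T = "deviation :: 'n::{finite,linorder} \<Rightarrow> 'd \<Rightarrow> real^'d^('n::{finite,linorder}) \<Rightarrow> real"
  let ?H = "{k. wt k = 1}"
  define R' where "R' x b = 2 * (\<Sum>i\<in>UNIV. \<Sum>k\<in>?H. ?T i k x * b $ i $ k)" for x b :: "real^'d^('n::{finite,linorder})"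
  define W where "W i k x = u' x (lifted_field G i k x)" for i k x
  define g where "g i k x = 2 * a * ((u x \<bullet> u x) * (?T i k x / ?R x))" for i k x
  define g' where "g' i k x b = 2 * a * (2 * (u x \<bullet> u' x b) * ?T i k x / ?R x
      + (u x \<bullet> u x) * (?T i k b / ?R x - ?T i k x * R' x b / (?R x)\<^sup>2))" for i k x b
  have R': "(?R has_derivative R' x) (at x)" for x
    unfolding R'_def by (rule spread_has_derivative)
  have T': "(?T i k has_derivative ?T i k) (at x)" for i k x
    by (rule bounded_linear_imp_has_derivative[OF bounded_linear_deviation])
  have R0: "?R x \<noteq> 0" if "x \<in> \<Omega>" for x using pos[OF that] by simp
  have g: "(g i k has_derivative g' i k x) (at x)" if "x \<in> \<Omega>" for i k x
    unfolding g_def[abs_def] g'_def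
    by (rule derivative_eq_intros refl u[OF that] R' T' R0[OF that])+
      (use R0[OF that] in \<open>auto simp: field_simps inner_commute power2_eq_square fun_eq_iff\<close>)
  have cu: "continuous_on \<Omega> u"
    by (intro has_derivative_continuous_on) (use u has_derivative_at_withinI in blast)
  have cR: "continuous_on \<Omega> ?R"
    by (intro has_derivative_continuous_on) (use R' has_derivative_at_withinI in blast)
  have cT: "continuous_on \<Omega> (?T i k)" for i k
    by (intro has_derivative_continuous_on) (use T' has_derivative_at_withinI in blast)
  have cR': "continuous_on \<Omega> (\<lambda>x. R' x b)" for b
    unfolding R'_def by (intro continuous_intros cT)
  have cg': "continuous_on \<Omega> (\<lambda>x. g' i k x b)" for i k b
    unfolding g'_def using R0 by (intro continuous_intros cu cT cR cR' cont) auto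
  have cW: "continuous_on \<Omega> (W i k)" for i k
    unfolding W_def[abs_def]
    by (rule continuous_on_linear_field[OF _ cont continuous_on_subset[OF continuous_lifted_field]])
      (use u has_derivative_linear in auto)
  have u'0: "u' x b = 0" if "x \<in> \<Omega>" "x \<notin> K" for x b
    using has_derivative_unique[OF u[OF that(1)]
        has_derivative_zero_outside_support[OF compact_imp_closed[OF K(1)] that(2) K(3)]]
    by simp
  note integrableI = set_integrable_continuous_zero_outside_compact[OF _ K(1,2)]

  \<comment> \<open>The integrands in terms of \<open>u\<close>, its derivative and the quadratic form alone: \<open>F\<close> and \<open>P\<close> are the
    two gradient terms, \<open>Q\<close> is the Hardy term and \<open>D\<close> collects the total derivatives. These
    formulas make continuity on \<open>\<Omega>\<close> evident.\<close>
  define F where "F x = (\<Sum>i\<in>UNIV. \<Sum>k\<in>?H. (norm (W i k x))\<^sup>2)" for x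
  define P where "P x = (\<Sum>i\<in>UNIV. \<Sum>k\<in>?H. (norm (W i k x - (a * (2 * ?T i k x) / ?R x) *\<^sub>R u x))\<^sup>2)" for x
  define Q where "Q x = (norm (u x))\<^sup>2 / ?R x" for x
  define D where "D x = (\<Sum>i\<in>UNIV. \<Sum>k\<in>?H. g' i k x (lifted_field G i k x))" for x

  have F: "(norm (horizontal_gradient G wt u x))\<^sup>2 = F x" if "x \<in> \<Omega>" for x
    unfolding F_def W_def by (rule norm_horizontal_gradient_square[OF u[OF that]])
  have Q: "(norm (u x))\<^sup>2 / (rho G wt x)\<^sup>2 = Q x" if "x \<in> \<Omega>" for x
    using pos[OF that] by (simp add: Q_def rho_eq)
  have rho_powr: "rho G wt x powr (2 * c) = ?R x powr c" for x c
    by (simp add: rho_eq powr_powr spread_nonneg flip: powr_half_sqrt)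
  have R'V: "R' x (lifted_field G i k x) = 2 * ?T i k x" if "k \<in> ?H" for i k x
    unfolding R'_def using sum_deviation_lifted_field[of k x i] that by simp
  have P: "(norm (horizontal_gradient G wt v x))\<^sup>2 * rho G wt x powr (4 * a) = P x" if x: "x \<in> \<Omega>" for x
  proof -
    have v: "v = (\<lambda>y. ?R y powr (- a) *\<^sub>R u y)"
      using rho_powr[of _ "- a"] by (simp add: v_def)
    have "(norm (horizontal_gradient G wt v x))\<^sup>2
      = (\<Sum>i\<in>UNIV. \<Sum>k\<in>?H. (norm (?R x powr (- a) *\<^sub>R (u' x (lifted_field G i k x)
            - (a * R' x (lifted_field G i k x) / ?R x) *\<^sub>R u x)))\<^sup>2)"
      unfolding v by (rule norm_horizontal_gradient_square[OF powr_weighted_gradient[OF u[OF x] R' pos[OF x]]])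
    also have "\<dots> = (?R x powr (- a))\<^sup>2 * P x"
      unfolding P_def W_def sum_distrib_left by (intro sum.cong refl) (simp add: R'V power_mult_distrib)
    finally have "(norm (horizontal_gradient G wt v x))\<^sup>2 * rho G wt x powr (4 * a)
      = (?R x powr (- a))\<^sup>2 * P x * ?R x powr (2 * a)"
      using rho_powr[of x "2 * a"] by simp
    also have "(?R x powr (- a))\<^sup>2 * ?R x powr (2 * a) = 1"
      using R0[OF x] by (simp add: power2_eq_square flip: powr_add)
    then have "(?R x powr (- a))\<^sup>2 * P x * ?R x powr (2 * a) = P x" by (simp add: mult_ac)
    finally show ?thesis .
  qed

  have pointwise: "F x = 4 * real CARD('n) * a\<^sup>2 * Q x + P x + D x" if x: "x \<in> \<Omega>" for x
  proof -
    let ?rem = "\<lambda>i k. (4 * a - 4 * a\<^sup>2) * (?T i k x)\<^sup>2 / (?R x)\<^sup>2 - 2 * a * (real CARD('n) - 1) / ?R x"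
    have "(norm (W i k x))\<^sup>2 = (norm (W i k x - (a * (2 * ?T i k x) / ?R x) *\<^sub>R u x))\<^sup>2
        + g' i k x (lifted_field G i k x) + (u x \<bullet> u x) * ?rem i k" if "k \<in> ?H" for i k
      unfolding hardy_expansion[OF pos[OF x], of "W i k x" a "?T i k x" "u x" "real CARD('n) - 1"] g'_def
      using that R'V[OF that, of x i] deviation_lifted_field[of k i x] by (simp add: W_def)
    then have "F x = P x + D x + (u x \<bullet> u x) * (\<Sum>i\<in>UNIV. \<Sum>k\<in>?H. ?rem i k)"
      unfolding F_def P_def D_def sum_distrib_left sum.distrib[symmetric] by (intro sum.cong refl) simp
    also have "(\<Sum>i\<in>UNIV. \<Sum>k\<in>?H. ?rem i k) = 4 * real CARD('n) * a\<^sup>2 / ?R x"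
      by (rule sum_hardy_remainder[OF a pos[OF x]])
    finally show ?thesis by (simp add: Q_def power2_norm_eq_inner)
  qed

  have iF: "set_integrable lborel \<Omega> F"
    by (rule integrableI) (auto simp: F_def[abs_def] W_def u'0 intro!: continuous_intros cW[unfolded W_def[abs_def]])
  have iP: "set_integrable lborel \<Omega> P"
    by (rule integrableI)
      (auto simp: P_def[abs_def] W_def u'0 K(3) R0 intro!: continuous_intros cW[unfolded W_def[abs_def]] cT cR cu)
  have iQ: "set_integrable lborel \<Omega> Q"
    by (rule integrableI) (auto simp: Q_def[abs_def] K(3) R0 intro!: continuous_intros cR cu)
  have field: "set_integrable lborel \<Omega> (\<lambda>x. g' i k x (lifted_field G i k x))"
      "(LINT x:\<Omega>|lborel. g' i k x (lifted_field G i k x)) = 0" if k: "k \<in> ?H" for i k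
  proof -
    obtain A where A: "\<And>x b. ((\<lambda>x :: real^'d^('n::{finite,linorder}). lifted_field G i k x \<bullet> b) has_derivative A b x) (at x)"
      "\<And>x b. b \<in> Basis \<Longrightarrow> A b x b = 0"
      using lifted_field_divergence_free[of k i] k by blast
    have g0: "g i k x = 0" if "x \<notin> K" for x using K(3)[OF that] by (simp add: g_def)
    note * = integral_divergence_free_field_eq_zero[OF \<open>open \<Omega>\<close> g cg' K(1,2) g0 A]
    show "set_integrable lborel \<Omega> (\<lambda>x. g' i k x (lifted_field G i k x))" by (rule *(1))
    show "(LINT x:\<Omega>|lborel. g' i k x (lifted_field G i k x)) = 0" by (rule *(2))
  qed
  have iD: "set_integrable lborel \<Omega> D"
    using field(1) unfolding set_integrable_def D_def scaleR_sum_right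
    by (intro Bochner_Integration.integrable_sum) blast
  have D0: "(LINT x:\<Omega>|lborel. D x) = 0"
    using field unfolding set_integrable_def set_lebesgue_integral_def D_def scaleR_sum_right
    by (simp only: Bochner_Integration.integral_sum Bochner_Integration.integrable_sum sum.neutral_const cong: sum.cong)

  show ?I1 using iF F by (simp cong: set_integrable_cong)
  show ?I2 using iQ Q by (simp cong: set_integrable_cong)
  show ?I3 using iP P by (simp cong: set_integrable_cong)
  have cong: "(LINT x:\<Omega>|lborel. f x) = (LINT x:\<Omega>|lborel. h x)" if "\<And>x. x \<in> \<Omega> \<Longrightarrow> f x = h x"
    for f h :: "real^'d^('n::{finite,linorder}) \<Rightarrow> real"
    unfolding set_lebesgue_integral_def
    by (rule Bochner_Integration.integral_cong) (auto simp: that indicator_def)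
  have "(LINT x:\<Omega>|lborel. (norm (horizontal_gradient G wt u x))\<^sup>2)
      = (LINT x:\<Omega>|lborel. 4 * real CARD('n) * a\<^sup>2 * Q x + P x + D x)"
    by (rule cong) (simp add: F pointwise)
  also have "\<dots> = 4 * real CARD('n) * a\<^sup>2 * (LINT x:\<Omega>|lborel. Q x) + (LINT x:\<Omega>|lborel. P x)"
    using iP iQ iD D0 by simp
  also have "(LINT x:\<Omega>|lborel. Q x) = (LINT x:\<Omega>|lborel. (norm (u x))\<^sup>2 / (rho G wt x)\<^sup>2)"
    by (rule cong) (simp add: Q)
  also have "(LINT x:\<Omega>|lborel. P x)
      = (LINT x:\<Omega>|lborel. (norm (horizontal_gradient G wt v x))\<^sup>2 * rho G wt x powr (4 * a))"
    by (rule cong) (simp add: P)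
  finally show ?E .
qed

end

theorem theorem5p3:
  fixes G :: "(real^'d) monoid"
    and wt :: "'d \<Rightarrow> nat"
    and r n N :: nat
    and \<alpha> :: real
    and \<Omega> :: "(real^'d^('n::{finite,linorder})) set"
  assumes "stratified_group G wt r"
    and N: "N = card {k. wt k = 1}"
    and n: "n = CARD('n)" "n \<ge> 2"
    and "open \<Omega>"
    and "\<And>x i j. x \<in> \<Omega> \<Longrightarrow> i \<noteq> j \<Longrightarrow> first_stratum wt (x $ i) \<noteq> first_stratum wt (x $ j)"
    and \<alpha>: "\<alpha> = (2 - (real n - 1) * real N) / 4"
  shows "(\<forall>x :: real^'d^('n::{finite,linorder}). (rho G wt x)\<^sup>2 =
           (\<Sum>(i, j) \<in> {(i, j). i < j}. (norm (first_stratum wt (x $ i) - first_stratum wt (x $ j)))\<^sup>2)) \<and>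
         (\<forall>u \<in> test_functions \<Omega>.
           set_integrable lborel \<Omega> (\<lambda>x. (norm (horizontal_gradient G wt u x))\<^sup>2) \<and>
           set_integrable lborel \<Omega> (\<lambda>x. (norm (u x))\<^sup>2 / (rho G wt x)\<^sup>2) \<and>
           set_integrable lborel \<Omega>
             (\<lambda>x. (norm (horizontal_gradient G wt (\<lambda>y. rho G wt y powr (- 2 * \<alpha>) *\<^sub>R u y) x))\<^sup>2
                  * rho G wt x powr (4 * \<alpha>)) \<and>
           (LINT x:\<Omega>|lborel. (norm (horizontal_gradient G wt u x))\<^sup>2) =
             real n * ((real n - 1) / 2 * real N - 1)\<^sup>2
               * (LINT x:\<Omega>|lborel. (norm (u x))\<^sup>2 / (rho G wt x)\<^sup>2)
             + (LINT x:\<Omega>|lborel.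
                  (norm (horizontal_gradient G wt (\<lambda>y. rho G wt y powr (- 2 * \<alpha>) *\<^sub>R u y) x))\<^sup>2
                  * rho G wt x powr (4 * \<alpha>)))"
proof (intro conjI allI ballI)
  interpret stratified_group G wt r by fact
  show "(rho G wt x)\<^sup>2 =
      (\<Sum>(i, j) \<in> {(i, j). i < j}. (norm (first_stratum wt (x $ i) - first_stratum wt (x $ j)))\<^sup>2)"
    for x :: "real^'d^('n::{finite,linorder})"
    by (simp add: rho_eq spread_nonneg flip: spread_eq_sum_pairs)
  fix u :: "real^'d^('n::{finite,linorder}) \<Rightarrow> complex"
  assume "u \<in> test_functions \<Omega>"
  then have smooth: "smooth_on \<Omega> u" and K: "compact (closure {x. u x \<noteq> 0})" "closure {x. u x \<noteq> 0} \<subseteq> \<Omega>"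
    by (auto simp: test_functions_def)
  have K0: "u x = 0" if "x \<notin> closure {x. u x \<noteq> 0}" for x
    using that closure_subset[of "{x. u x \<noteq> 0}"] by blast
  obtain i j :: "'n::{finite,linorder}" where "i < j"
    using n card_le_Suc0_iff_eq[of "UNIV :: 'n::{finite,linorder} set"] by (force simp: neq_iff)
  then have pos: "0 < spread wt x" if "x \<in> \<Omega>" for x
    using assms(6)[OF that, of i j] by (intro spread_pos) auto
  have a: "4 * \<alpha> = 2 - (real CARD('n) - 1) * real (card {k. wt k = 1})"
    using \<alpha> N n by simp
  have c: "4 * real CARD('n) * \<alpha>\<^sup>2 = real n * ((real n - 1) / 2 * real N - 1)\<^sup>2"
    unfolding \<alpha> n(1)[symmetric] by (simp add: field_simps power2_eq_square)
  note hardy = hardy_identity[OF \<open>open \<Omega>\<close> pos smooth_on_has_derivative[OF smooth]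
      smooth_on_imp_continuous_on[OF smooth_on_frechet_derivative[OF smooth]] K K0 a, unfolded c]
  show "set_integrable lborel \<Omega> (\<lambda>x. (norm (horizontal_gradient G wt u x))\<^sup>2)"
    by (rule hardy(1))
  show "set_integrable lborel \<Omega> (\<lambda>x. (norm (u x))\<^sup>2 / (rho G wt x)\<^sup>2)"
    by (rule hardy(2))
  show "set_integrable lborel \<Omega>
      (\<lambda>x. (norm (horizontal_gradient G wt (\<lambda>y. rho G wt y powr (- 2 * \<alpha>) *\<^sub>R u y) x))\<^sup>2
         * rho G wt x powr (4 * \<alpha>))"
    by (rule hardy(3))
  show "(LINT x:\<Omega>|lborel. (norm (horizontal_gradient G wt u x))\<^sup>2) =
      real n * ((real n - 1) / 2 * real N - 1)\<^sup>2 * (LINT x:\<Omega>|lborel. (norm (u x))\<^sup>2 / (rho G wt x)\<^sup>2)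
      + (LINT x:\<Omega>|lborel.
           (norm (horizontal_gradient G wt (\<lambda>y. rho G wt y powr (- 2 * \<alpha>) *\<^sub>R u y) x))\<^sup>2
           * rho G wt x powr (4 * \<alpha>))"
    by (rule hardy(4))
qed

end
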